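(* Let $G$ be either the De Bruijn digraph $B(d,D)$ or the Kautz digraph $K(d,D)$, with vertex set $V$. Let $v\in V$ and $0\le i\le D$. Then $$|S_{i}^\star(v)|=d^i-a_{i-1}d^{i-1}-\cdots -a_{1} d-a_{0},$$ where each coefficient $a_{k}$ ($0\le k\le i-1$) is $0$ or $1$, and $a_{k}=1$ if and only if $S_{k,i}(v)\neq\emptyset$. In particular, if $i\ge 1$ and $v=v_1v_2\cdots v_D$, then $a_{i-1}=1$ if and only if $G=B(d,D)$ and $v_i=v_{i+1}=\cdots=v_D$.
   Context: Let $d\ge 2$ and $D\ge 1$ be integers. The De Bruijn digraph $B(d,D)$ has as vertices all words $v=v_1v_2\cdots v_D$ over an alphabet $A$ with $|A|=d$; $v$ is adjacent to the $d$ vertices $v_2\cdots v_D v_{D+1}$, $v_{D+1}\in A$ (loops occur). The Kautz digraph $K(d,D)$ has as vertices all words $v=v_1v_2\cdots v_D$ over an alphabet $A$ with $|A|=d+1$ such that $v_k\ne v_{k+1}$ for $1\le k<D$; $v$ is adjacent to the $d$ vertices $v_2\cdots v_Dv_{D+1}$ with $v_{D+1}\in A$, $v_{D+1}\ne v_D$. Both are $d$-regular of diameter $D$. For $v\in V$ and $i\ge 0$, $S_i(v)$ is the set of vertices $u$ for which there is a walk of length exactly $i$ from $v$ to $u$, and $S_i^\star(v)$ is the set of vertices at (directed) distance exactly $i$ from $v$. For integers $0\le k\le i\le D$: $S_{k,i}(v)=S_k(v)$ if $S_k(v)\subseteq S_i(v)$ and, for all $j$ with $k<j<i$ such that $S_j(v)\subseteq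 S_i(v)$, we have $S_k(v)\not\subseteq S_j(v)$; otherwise $S_{k,i}(v)=\emptyset$. *)

theory Defs
  imports "Graph_Theory.Graph_Theory"
begin

definition de_bruijn_words :: "'a set \<Rightarrow> nat \<Rightarrow> 'a list set" where
  "de_bruijn_words A D = {w. length w = D \<and> set w \<subseteq> A}"

definition kautz_words :: "'a set \<Rightarrow> nat \<Rightarrow> 'a list set" where
  "kautz_words A D = {w. length w = D \<and> set w \<subseteq> A \<and> distinct_adj w}"

definition de_bruijn_digraph :: "'a set \<Rightarrow> nat \<Rightarrow> 'a list pair_pre_digraph" where
  "de_bruijn_digraph A D =
     \<lparr> pverts = de_bruijn_words A D,
       parcs = {(w, tl w @ [x]) | w x. w \<in> de_bruijn_words A D \<and> x \<in> A} \<rparr>"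

definition kautz_digraph :: "'a set \<Rightarrow> nat \<Rightarrow> 'a list pair_pre_digraph" where
  "kautz_digraph A D =
     \<lparr> pverts = kautz_words A D,
       parcs = {(w, tl w @ [x]) | w x. w \<in> kautz_words A D \<and> x \<in> A \<and> x \<noteq> last w} \<rparr>"

text \<open>The alphabet is arbitrary of the prescribed size: \<open>d\<close> letters for \<open>B(d,D)\<close>,
  but \<open>d + 1\<close> letters for \<open>K(d,D)\<close>, so that both digraphs are \<open>d\<close>-regular.\<close>

definition is_de_bruijn :: "nat \<Rightarrow> nat \<Rightarrow> 'a list pair_pre_digraph \<Rightarrow> bool" where
  "is_de_bruijn d D G \<longleftrightarrow> (\<exists>A. finite A \<and> card A = d \<and> G = de_bruijn_digraph A D)"

definition is_kautz :: "nat \<Rightarrow> nat \<Rightarrow> 'a list pair_pre_digraph \<Rightarrow> bool" where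
  "is_kautz d D G \<longleftrightarrow> (\<exists>A. finite A \<and> card A = d + 1 \<and> G = kautz_digraph A D)"

lemma pair_wf_digraph_de_bruijn:
  assumes "D \<ge> 1"
  shows "pair_wf_digraph (de_bruijn_digraph A D)"
proof -
  have "tl w @ [x] \<in> de_bruijn_words A D" if "w \<in> de_bruijn_words A D" "x \<in> A" for w x
    using that assms by (cases w) (auto simp: de_bruijn_words_def)
  then show ?thesis
    by unfold_locales (auto simp: de_bruijn_digraph_def)
qed

lemma pair_wf_digraph_kautz:
  assumes "D \<ge> 1"
  shows "pair_wf_digraph (kautz_digraph A D)"
proof -
  have "tl w @ [x] \<in> kautz_words A D"
    if "w \<in> kautz_words A D" "x \<in> A" "x \<noteq> last w" for w x
    using that assms
    by (cases w) (auto simp: kautz_words_def distinct_adj_Cons distinct_adj_append_iff)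
  then show ?thesis
    by unfold_locales (auto simp: kautz_digraph_def)
qed

text \<open>Walks may repeat vertices and arcs, and a walk is given by its list of arcs, so
  its length is the length of that list.\<close>

definition walk_sphere :: "('a, 'b) pre_digraph \<Rightarrow> nat \<Rightarrow> 'a \<Rightarrow> 'a set" where
  "walk_sphere G i v = {u. \<exists>p. pre_digraph.awalk G v p u \<and> length p = i}"

text \<open>The directed distance is the minimal walk cost for unit arc weights; it is
  infinite for unreachable vertices.\<close>

definition dist_sphere :: "('a, 'b) pre_digraph \<Rightarrow> nat \<Rightarrow> 'a \<Rightarrow> 'a set" where
  "dist_sphere G i v = {u \<in> verts G. wf_digraph.\<mu> G (\<lambda>_. 1) v u = ereal (real i)}"

definition max_sphere :: "('a, 'b) pre_digraph \<Rightarrow> nat \<Rightarrow> nat \<Rightarrow> 'a \<Rightarrow> 'a set" where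
  "max_sphere G k i v =
     (if walk_sphere G k v \<subseteq> walk_sphere G i v \<and>
         (\<forall>j. k < j \<and> j < i \<and> walk_sphere G j v \<subseteq> walk_sphere G i v \<longrightarrow>
              \<not> walk_sphere G k v \<subseteq> walk_sphere G j v)
      then walk_sphere G k v else {})"

end

theory Submission
  imports Defs
begin

text \<open>
  Both digraphs are instances of one construction. Fix a relation \<open>R\<close> on the alphabet such that every
  letter has exactly \<open>d\<close> successors; the vertices are the words of length \<open>D\<close> whose consecutive
  letters are related by \<open>R\<close>, and an arc appends a letter and drops the first one. De Bruijn digraphs
  arise from the full relation, Kautz digraphs from \<open>\<noteq>\<close>.

  A walk of length \<open>i\<close> from \<open>v\<close> is an admissible continuation \<open>x\<close> of \<open>v\<close> by \<open>i\<close> letters, and it ends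
  in \<open>drop i (v @ x)\<close> (\<open>walk_sphere_eq_sphere\<close>). For \<open>i \<le> D\<close> this end vertex is \<open>drop i v @ x\<close>, from
  which \<open>x\<close> can be read off, so that the sphere of radius \<open>i\<close> has \<open>d ^ i\<close> elements (\<open>card_sphere\<close>).

  Whether a word \<open>drop k v @ x\<close> of the sphere of radius \<open>k < i\<close> lies in the sphere of radius \<open>i\<close> is a
  condition on its nonempty prefix \<open>drop k v\<close> alone, because admissibility only looks at
  neighbouring letters. As this prefix is the same for the whole sphere, the smaller sphere is either
  contained in the larger one or disjoint from it (\<open>sphere_laminar\<close>). The spheres of radius less than
  \<open>i\<close> that are contained in the sphere of radius \<open>i\<close> thus form a laminar family, whose union is the
  disjoint union of its maximal members; removing it leaves the vertices at distance exactly \<open>i\<close>,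
  and each maximal member of radius \<open>k\<close> accounts for a term \<open>d ^ k\<close>
  (\<open>card_diff_laminar\<close>).

  For \<open>k = i - 1\<close> no intermediate radius exists, so the coefficient is 1 if and only if the two
  consecutive spheres are nested. Comparing prefixes, this forces the letters of \<open>v\<close> from the
  \<open>i\<close>-th on to be equal, and the last one to be repeatable (\<open>sphere_subset_sphere_Suc_iff\<close>); the
  latter never happens in a Kautz digraph.
\<close>

section \<open>Counting with laminar families\<close>

definition maximal_below :: "(nat \<Rightarrow> 'b set) \<Rightarrow> nat \<Rightarrow> nat set" where
  "maximal_below S i =
     {k. k < i \<and> S k \<subseteq> S i \<and> (\<forall>j. k < j \<and> j < i \<and> S j \<subseteq> S i \<longrightarrow> \<not> S k \<subseteq> S j)}"

lemma subset_maximal_below: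
  assumes "k < i" "S k \<subseteq> S i"
  shows "\<exists>m\<in>maximal_below S i. S k \<subseteq> S m"
  using assms
proof (induction "i - k" arbitrary: k rule: less_induct)
  case less
  show ?case
  proof (cases "k \<in> maximal_below S i")
    case False
    then obtain j where j: "k < j" "j < i" "S j \<subseteq> S i" "S k \<subseteq> S j"
      using less.prems by (auto simp: maximal_below_def)
    with less.hyps[of j] show ?thesis
      by (metis diff_less_mono2 less_trans order_trans)
  qed auto
qed

text \<open>Climbing from \<open>S k\<close> to larger members below \<open>i\<close> stops at a maximal one (\<open>subset_maximal_below\<close>). By laminarity the members below \<open>i\<close> that meet \<open>S i\<close> are contained in it, hence in a maximal one,
  and two maximal ones are disjoint since neither contains the other.\<close>

lemma card_diff_laminar:
  fixes S :: "nat \<Rightarrow> 'b set"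
  assumes fin: "\<And>k. k \<le> i \<Longrightarrow> finite (S k)"
    and laminar: "\<And>k j. k < j \<Longrightarrow> j \<le> i \<Longrightarrow> S k \<inter> S j = {} \<or> S k \<subseteq> S j"
  shows "int (card (S i - (\<Union>k<i. S k))) = int (card (S i)) - (\<Sum>k\<in>maximal_below S i. int (card (S k)))"
proof -
  let ?M = "maximal_below S i"
  have finM: "finite ?M"
    by (rule finite_subset[of _ "{..<i}"]) (auto simp: maximal_below_def)
  have *: "S i - (\<Union>k<i. S k) = S i - (\<Union>k\<in>?M. S k)"
  proof
    show "S i - (\<Union>k<i. S k) \<subseteq> S i - (\<Union>k\<in>?M. S k)"
      by (auto simp: maximal_below_def)
    show "S i - (\<Union>k\<in>?M. S k) \<subseteq> S i - (\<Union>k<i. S k)"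
    proof
      fix u assume u: "u \<in> S i - (\<Union>k\<in>?M. S k)"
      have "u \<notin> S k" if "k < i" for k
      proof
        assume "u \<in> S k"
        with u laminar[OF that] have "S k \<subseteq> S i" by auto
        with subset_maximal_below[OF that] \<open>u \<in> S k\<close> u show False by blast
      qed
      with u show "u \<in> S i - (\<Union>k<i. S k)" by auto
    qed
  qed
  have disj: "S k \<inter> S j = {}" if "k \<in> ?M" "j \<in> ?M" "k < j" for k j
    using that laminar[of k j] by (auto simp: maximal_below_def)
  have sub: "(\<Union>k\<in>?M. S k) \<subseteq> S i"
    by (auto simp: maximal_below_def)
  have finS: "\<forall>k\<in>?M. finite (S k)"
    using fin by (auto simp: maximal_below_def)
  have "card (\<Union>k\<in>?M. S k) = (\<Sum>k\<in>?M. card (S k))"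
  proof (rule card_UN_disjoint[OF finM finS], intro ballI impI)
    fix k j assume "k \<in> ?M" "j \<in> ?M" "k \<noteq> j"
    then show "S k \<inter> S j = {}"
      using disj[of k j] disj[of j k] by (cases "k < j") auto
  qed
  moreover have "card (S i - (\<Union>k\<in>?M. S k)) = card (S i) - card (\<Union>k\<in>?M. S k)"
    using sub fin[of i] by (intro card_Diff_subset) (auto intro: finite_subset)
  moreover have "card (\<Union>k\<in>?M. S k) \<le> card (S i)"
    using sub fin[of i] by (intro card_mono) auto
  ultimately show ?thesis
    using * by (simp add: of_nat_diff)
qed

section \<open>Spheres in arbitrary digraphs\<close>

context wf_digraph
begin

lemma walk_sphere_0: "v \<in> verts G \<Longrightarrow> walk_sphere G 0 v = {v}"
  by (auto simp: walk_sphere_def awalk_Nil_iff)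

lemma walk_sphere_Suc:
  "walk_sphere G (Suc i) v = head G ` {e \<in> arcs G. tail G e \<in> walk_sphere G i v}"
proof (intro equalityI subsetI)
  fix w assume "w \<in> walk_sphere G (Suc i) v"
  then obtain p where p: "awalk v p w" "length p = Suc i"
    by (auto simp: walk_sphere_def)
  then obtain q e where qe: "p = q @ [e]"
    by (metis length_Suc_conv_rev)
  with p have "awalk v q (tail G e)" "e \<in> arcs G" "w = head G e"
    by (auto simp: awalk_simps)
  with p qe show "w \<in> head G ` {e \<in> arcs G. tail G e \<in> walk_sphere G i v}"
    by (auto simp: walk_sphere_def)
next
  fix w assume "w \<in> head G ` {e \<in> arcs G. tail G e \<in> walk_sphere G i v}"
  then obtain e p where "e \<in> arcs G" "w = head G e" "awalk v p (tail G e)" "length p = i"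
    by (auto simp: walk_sphere_def)
  then have "awalk v (p @ [e]) w" "length (p @ [e]) = Suc i"
    by (auto simp: awalk_simps)
  then show "w \<in> walk_sphere G (Suc i) v"
    unfolding walk_sphere_def by blast
qed

text \<open>Walk lengths are natural numbers, so the infimum that defines the distance is attained as soon as
  there is a walk at all.\<close>

lemma dist_sphere_eq: "dist_sphere G i v = walk_sphere G i v - (\<Union>k<i. walk_sphere G k v)"
proof -
  have cost: "awalk_cost (\<lambda>_. 1) p = real (length p)" for p
    by (induction p) auto
  have "\<mu> (\<lambda>_. 1) v u = ereal (real i) \<longleftrightarrow>
        u \<in> walk_sphere G i v \<and> (\<forall>k<i. u \<notin> walk_sphere G k v)" for u
  proof (cases "\<exists>p. awalk v p u")
    case False
    then show ?thesis
      by (auto simp: \<mu>_def walk_sphere_def top_ereal_def)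
  next
    case True
    define n where "n = (LEAST n. u \<in> walk_sphere G n v)"
    have ex: "\<exists>n. u \<in> walk_sphere G n v"
      using True by (auto simp: walk_sphere_def)
    have n: "u \<in> walk_sphere G n v"
      unfolding n_def by (rule LeastI_ex[OF ex])
    have least: "n \<le> k" if "u \<in> walk_sphere G k v" for k
      using that unfolding n_def by (rule Least_le)
    have "\<mu> (\<lambda>_. 1) v u = ereal (real n)"
      unfolding \<mu>_def
    proof (rule INF_eqI)
      fix p assume "p \<in> {p. awalk v p u}"
      then show "ereal (real n) \<le> ereal (awalk_cost (\<lambda>_. 1) p)"
        using least[of "length p"] by (auto simp: cost walk_sphere_def)
    next
      fix y assume "\<And>p. p \<in> {p. awalk v p u} \<Longrightarrow> y \<le> ereal (awalk_cost (\<lambda>_. 1) p)"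
      then show "y \<le> ereal (real n)"
        using n by (auto simp: cost walk_sphere_def)
    qed
    moreover have "n = i \<longleftrightarrow> u \<in> walk_sphere G i v \<and> (\<forall>k<i. u \<notin> walk_sphere G k v)"
      using n least by (metis leD le_neq_implies_less)
    ultimately show ?thesis
      by simp
  qed
  moreover have "walk_sphere G i v \<subseteq> verts G"
    by (auto simp: walk_sphere_def awalk_last_in_verts)
  ultimately show ?thesis
    by (auto simp: dist_sphere_def)
qed

end

section \<open>Digraphs of words with restricted neighbouring letters\<close>

definition chain_words :: "'a set \<Rightarrow> ('a \<Rightarrow> 'a \<Rightarrow> bool) \<Rightarrow> nat \<Rightarrow> 'a list set" where
  "chain_words A R n = {w. length w = n \<and> set w \<subseteq> A \<and> successively R w}"

definition chain_digraph :: "'a set \<Rightarrow> ('a \<Rightarrow> 'a \<Rightarrow> bool) \<Rightarrow> nat \<Rightarrow> 'a list pair_pre_digraph" where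
  "chain_digraph A R D =
     \<lparr> pverts = chain_words A R D,
       parcs = {(w, tl w @ [x]) | w x. w \<in> chain_words A R D \<and> x \<in> A \<and> R (last w) x} \<rparr>"

lemma de_bruijn_eq_chain_digraph: "de_bruijn_digraph A D = chain_digraph A (\<lambda>_ _. True) D"
proof -
  have "successively (\<lambda>_ _. True) w" for w :: "'a list"
    by (induction w) (auto simp: successively_Cons)
  then show ?thesis
    by (simp add: de_bruijn_digraph_def chain_digraph_def de_bruijn_words_def chain_words_def)
qed

lemma kautz_eq_chain_digraph: "kautz_digraph A D = chain_digraph A (\<noteq>) D"
  unfolding kautz_digraph_def chain_digraph_def kautz_words_def chain_words_def
  by (simp add: distinct_adj_def eq_commute)

locale regular_chain =
  fixes A :: "'a set" and R :: "'a \<Rightarrow> 'a \<Rightarrow> bool" and d D :: nat and v :: "'a list"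
  assumes finite_alphabet: "finite A"
    and regular: "x \<in> A \<Longrightarrow> card {y \<in> A. R x y} = d"
    and d_pos: "d > 0"
    and D_pos: "D > 0"
    and v_word: "v \<in> chain_words A R D"
begin

lemma length_v: "length v = D" and set_v: "set v \<subseteq> A" and chain_v: "successively R v"
  and v_nonempty: "v \<noteq> []"
  using v_word D_pos by (auto simp: chain_words_def)

sublocale digraph: pair_wf_digraph "chain_digraph A R D"
proof -
  have "tl w @ [x] \<in> chain_words A R D"
    if "w \<in> chain_words A R D" "x \<in> A" "R (last w) x" for w x
    using that D_pos
    by (cases w) (auto simp: chain_words_def successively_Cons successively_append_iff split: if_splits)
  then show "pair_wf_digraph (chain_digraph A R D)"
    by unfold_locales (auto simp: chain_digraph_def)
qed

text \<open>An extension records the letters appended along a walk from \<open>v\<close>; as \<open>D > 0\<close>, the word \<open>v @ x\<close> determines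
  the whole walk, whose vertices are the windows of length \<open>D\<close> of this word.\<close>

definition extensions :: "nat \<Rightarrow> 'a list set" where
  "extensions i = {x. length x = i \<and> set x \<subseteq> A \<and> successively R (v @ x)}"

definition sphere :: "nat \<Rightarrow> 'a list set" where
  "sphere i = (\<lambda>x. drop i (v @ x)) ` extensions i"

lemma extensions_Suc:
  "extensions (Suc i) =
     (\<lambda>(x, y). x @ [y]) ` (SIGMA x:extensions i. {y \<in> A. R (last (v @ x)) y})"
proof (intro equalityI subsetI)
  fix z assume z: "z \<in> extensions (Suc i)"
  then obtain x y where "z = x @ [y]"
    by (auto simp: extensions_def length_Suc_conv_rev)
  with z v_nonempty
  show "z \<in> (\<lambda>(x, y). x @ [y]) ` (SIGMA x:extensions i. {y \<in> A. R (last (v @ x)) y})"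
    by (auto simp: extensions_def successively_append_iff[of _ "v @ x" "[y]", simplified])
next
  fix z
  assume "z \<in> (\<lambda>(x, y). x @ [y]) ` (SIGMA x:extensions i. {y \<in> A. R (last (v @ x)) y})"
  then obtain x y where "z = x @ [y]" "x \<in> extensions i" "y \<in> A" "R (last (v @ x)) y"
    by auto
  with successively_append_iff[of R "v @ x" "[y]"] show "z \<in> extensions (Suc i)"
    by (auto simp: extensions_def)
qed

lemma finite_extensions: "finite (extensions i)"
  by (rule finite_subset[OF _ finite_lists_length_eq[OF finite_alphabet, of i]])
    (auto simp: extensions_def)

lemma card_extensions: "card (extensions i) = d ^ i"
proof (induction i)
  case 0
  have "extensions 0 = {[]}"
    using chain_v by (auto simp: extensions_def)
  then show ?case by simp
next
  case (Suc i)
  have last_in: "last (v @ x) \<in> A" if "x \<in> extensions i" for x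
    using that set_v v_nonempty last_in_set[of "v @ x"] by (auto simp: extensions_def)
  have "card (extensions (Suc i)) = card (SIGMA x:extensions i. {y \<in> A. R (last (v @ x)) y})"
    unfolding extensions_Suc by (intro card_image inj_onI) auto
  also have "\<dots> = (\<Sum>x\<in>extensions i. card {y \<in> A. R (last (v @ x)) y})"
    using finite_extensions finite_alphabet by (intro card_SigmaI) auto
  also have "\<dots> = d ^ Suc i"
    using Suc last_in by (simp add: regular)
  finally show ?case .
qed

lemma extensions_nonempty: "extensions i \<noteq> {}"
  using card_extensions[of i] d_pos by auto

lemma finite_sphere: "finite (sphere i)"
  by (simp add: sphere_def finite_extensions)

lemma sphere_nonempty: "sphere i \<noteq> {}"
  by (simp add: sphere_def extensions_nonempty)

lemma sphere_eq: "i \<le> D \<Longrightarrow> sphere i = (@) (drop i v) ` extensions i"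
  by (simp add: sphere_def length_v)

lemma card_sphere: "i \<le> D \<Longrightarrow> card (sphere i) = d ^ i"
  by (simp add: sphere_eq card_image inj_on_def card_extensions)

text \<open>A step of the walk only looks at the current vertex \<open>drop i (v @ x)\<close>, but as \<open>D > 0\<close> this vertex still
  shows the last letter of \<open>v @ x\<close>, and the admissibility of the next letter depends on nothing else.\<close>

lemma walk_sphere_eq_sphere: "walk_sphere (with_proj (chain_digraph A R D)) i v = sphere i"
proof (induction i)
  case 0
  have "extensions 0 = {[]}"
    using chain_v by (auto simp: extensions_def)
  moreover have "v \<in> verts (with_proj (chain_digraph A R D))"
    using v_word by (simp add: chain_digraph_def)
  ultimately show ?case
    by (simp add: digraph.walk_sphere_0 sphere_def)
next
  case (Suc i)
  let ?G = "chain_digraph A R D"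
  have word: "drop i (v @ x) \<in> chain_words A R D" if "x \<in> extensions i" for x
  proof -
    have "set (v @ x) \<subseteq> A" "length (v @ x) = D + i"
      using that set_v length_v by (auto simp: extensions_def)
    moreover have "successively R (take i (v @ x) @ drop i (v @ x))"
      using that unfolding append_take_drop_id by (simp add: extensions_def)
    then have "successively R (drop i (v @ x))"
      unfolding successively_append_iff by blast
    ultimately show ?thesis
      using set_drop_subset[of i "v @ x"] by (auto simp: chain_words_def)
  qed
  have last: "last (drop i (v @ x)) = last (v @ x)" if "x \<in> extensions i" for x
    using that D_pos length_v by (intro last_drop) (auto simp: extensions_def)
  have step: "drop (Suc i) (v @ x @ [y]) = tl (drop i (v @ x)) @ [y]"
    if "x \<in> extensions i" for x y
  proof -
    have "i < length (v @ x)"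
      using that D_pos length_v by (auto simp: extensions_def)
    then have "drop (Suc i) ((v @ x) @ [y]) = drop (Suc i) (v @ x) @ [y]"
      unfolding drop_append[of _ "v @ x"] by simp
    also have "drop (Suc i) (v @ x) = tl (drop i (v @ x))"
      unfolding drop_Suc by (rule drop_tl)
    finally show ?thesis
      by simp
  qed
  \<comment> \<open>Both the arcs leaving the sphere and the extensions by one more letter are indexed by \<open>?steps\<close>.\<close>
  let ?steps = "SIGMA x:extensions i. {y \<in> A. R (last (v @ x)) y}"
  have "walk_sphere (with_proj ?G) (Suc i) v = snd ` {e \<in> parcs ?G. fst e \<in> sphere i}"
    by (simp add: digraph.walk_sphere_Suc Suc)
  also have "{e \<in> parcs ?G. fst e \<in> sphere i} =
      (\<lambda>(x, y). (drop i (v @ x), tl (drop i (v @ x)) @ [y])) ` ?steps" (is "?L = ?r ` _")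
  proof (intro equalityI subsetI)
    fix e assume "e \<in> ?L"
    then obtain x y where x: "x \<in> extensions i" and y: "y \<in> A" "R (last (drop i (v @ x))) y"
      and e: "e = ?r (x, y)"
      unfolding chain_digraph_def sphere_def by (clarsimp simp del: drop_append)
    from x y have "(x, y) \<in> ?steps"
      by (simp only: last mem_Sigma_iff mem_Collect_eq)
    with e show "e \<in> ?r ` ?steps"
      by (rule image_eqI)
  next
    fix e assume "e \<in> ?r ` ?steps"
    then obtain x y where x: "x \<in> extensions i" and y: "y \<in> A" "R (last (v @ x)) y"
      and e: "e = ?r (x, y)"
      by blast
    have "R (last (drop i (v @ x))) y"
      using y by (simp only: last[OF x])
    with word[OF x] y have "e \<in> parcs ?G"
      unfolding e chain_digraph_def by (simp del: drop_append)
    moreover have "fst e \<in> sphere i"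
      using x unfolding e sphere_def by (simp del: drop_append)
    ultimately show "e \<in> ?L"
      by simp
  qed
  also have "snd ` (?r ` ?steps) = (\<lambda>x. drop (Suc i) (v @ x)) ` ((\<lambda>(x, y). x @ [y]) ` ?steps)"
    unfolding image_image
  proof (rule image_cong[OF refl])
    fix p assume "p \<in> ?steps"
    then show "snd (?r p) = drop (Suc i) (v @ (case p of (x, y) \<Rightarrow> x @ [y]))"
      by (cases p) (simp add: step del: drop_append)
  qed
  also have "\<dots> = sphere (Suc i)"
    unfolding sphere_def extensions_Suc ..
  finally show ?case .
qed

text \<open>A common vertex \<open>drop k v @ x = drop i v @ y\<close> forces \<open>drop k v = drop i v @ z\<close> and \<open>y = z @ x\<close>, where \<open>z\<close>
  is nonempty because \<open>k < i \<le> D\<close>. Then \<open>x\<close> may be replaced by any other extension \<open>x'\<close> of the same length: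
  neighbouring letters of \<open>v @ z @ x'\<close> are neighbours in \<open>v @ z\<close>, a prefix of \<open>v @ y\<close>, or in \<open>z @ x'\<close>,
  a suffix of \<open>v @ x'\<close>.\<close>

lemma sphere_laminar:
  assumes "k < i" "i \<le> D"
  shows "sphere k \<inter> sphere i = {} \<or> sphere k \<subseteq> sphere i"
proof (cases "sphere k \<inter> sphere i = {}")
  case False
  then obtain x y where x: "x \<in> extensions k" and y: "y \<in> extensions i"
    and eq: "drop k v @ x = drop i v @ y"
    using assms by (auto simp: sphere_eq)
  have "length (drop i v) < length (drop k v)"
    using assms length_v by simp
  moreover obtain z where "drop k v = drop i v @ z \<and> y = z @ x \<or> drop k v @ z = drop i v \<and> x = z @ y"
    using eq by (auto simp: append_eq_append_conv2)
  ultimately have z: "drop k v = drop i v @ z" "y = z @ x" "z \<noteq> []"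
    by (auto dest: arg_cong[of _ _ length] simp del: length_drop)
  have "sphere k \<subseteq> sphere i"
  proof
    fix u assume "u \<in> sphere k"
    then obtain x' where x': "x' \<in> extensions k" "u = drop k v @ x'"
      using assms by (auto simp: sphere_eq)
    have split: "v @ x' = (take k v @ drop i v) @ z @ x'"
      using append_take_drop_id[of k v] unfolding z(1) by (metis append.assoc)
    have "successively R (v @ x')"
      using x' by (simp add: extensions_def)
    then have "successively R ((take k v @ drop i v) @ z @ x')"
      by (simp only: split)
    then have "successively R (z @ x')"
      unfolding successively_append_iff by blast
    moreover have "successively R (v @ z)"
      using y z by (auto simp: extensions_def successively_append_iff)
    ultimately have "successively R (v @ z @ x')"
      using z(3) by (auto simp: successively_append_iff)
    then have "z @ x' \<in> extensions i"
      using x y x' z by (auto simp: extensions_def)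
    then show "u \<in> sphere i"
      using x' z assms by (auto simp: sphere_eq)
  qed
  then show ?thesis ..
qed simp

text \<open>Inclusion means \<open>drop k v = drop (Suc k) v @ [z]\<close> for a letter \<open>z\<close> that may follow \<open>v\<close>. A word that
  agrees with its own shift by one place is constant, so \<open>z\<close> and the letters of \<open>v\<close> at the (zero-based)
  positions \<open>k, ..., D - 1\<close> all coincide; in particular \<open>z\<close> is the last letter of \<open>v\<close>.\<close>

lemma sphere_subset_sphere_Suc_iff:
  assumes "k < D"
  shows "sphere k \<subseteq> sphere (Suc k) \<longleftrightarrow>
           R (last v) (last v) \<and> (\<forall>j\<in>{Suc k..<D}. v ! (j - 1) = v ! j)"
proof -
  have len: "length (drop k v) = Suc (length (drop (Suc k) v))"
    using assms length_v by simp
  have last: "last (drop k v) = last v"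
    using assms length_v by simp
  have drop_nth: "drop k v ! (j - Suc k) = v ! (j - 1)" "drop (Suc k) v ! (j - Suc k) = v ! j"
    if "j \<in> {Suc k..<D}" for j
    using that length_v by auto
  show ?thesis
  proof
    assume sub: "sphere k \<subseteq> sphere (Suc k)"
    obtain x where x: "x \<in> extensions k"
      using extensions_nonempty by blast
    with sub assms obtain y where y: "y \<in> extensions (Suc k)" "drop k v @ x = drop (Suc k) v @ y"
      by (auto simp: sphere_eq)
    obtain z x' where y': "y = z # x'" "length x' = length x"
      using x y by (cases y) (auto simp: extensions_def)
    then have z: "drop k v = drop (Suc k) v @ [z]"
      using y(2) y'(1) append_eq_append_conv[of "drop k v" "drop (Suc k) v @ [z]" x x'] y'(2) by simp
    then have "z = last v"
      using last by (metis last_snoc)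
    moreover have "R (last v) z"
      using y y' v_nonempty by (auto simp: extensions_def successively_append_iff)
    moreover have "v ! (j - 1) = v ! j" if j: "j \<in> {Suc k..<D}" for j
    proof -
      have "v ! (j - 1) = (drop (Suc k) v @ [z]) ! (j - Suc k)"
        using drop_nth(1)[OF j] z by simp
      also have "\<dots> = drop (Suc k) v ! (j - Suc k)"
        using j length_v by (intro nth_append_left) auto
      also have "\<dots> = v ! j"
        using drop_nth(2)[OF j] .
      finally show ?thesis .
    qed
    ultimately show "R (last v) (last v) \<and> (\<forall>j\<in>{Suc k..<D}. v ! (j - 1) = v ! j)"
      by simp
  next
    assume const: "R (last v) (last v) \<and> (\<forall>j\<in>{Suc k..<D}. v ! (j - 1) = v ! j)"
    have shift: "drop k v = drop (Suc k) v @ [last v]"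
    proof (rule nth_equalityI)
      fix n assume "n < length (drop k v)"
      then consider "n = D - Suc k" | "n < D - Suc k"
        using length_v by fastforce
      then show "drop k v ! n = (drop (Suc k) v @ [last v]) ! n"
      proof cases
        case 1
        then show ?thesis
          using length_v v_nonempty assms by (simp add: nth_append last_conv_nth)
      next
        case 2
        then have "n + Suc k \<in> {Suc k..<D}"
          by auto
        with const drop_nth[of "n + Suc k"] have "drop k v ! n = drop (Suc k) v ! n"
          by fastforce
        with 2 show ?thesis
          using length_v by (simp add: nth_append)
      qed
    qed (simp add: len del: length_drop)
    show "sphere k \<subseteq> sphere (Suc k)"
    proof
      fix u assume "u \<in> sphere k"
      then obtain x where x: "x \<in> extensions k" "u = drop k v @ x"
        using assms by (auto simp: sphere_eq)
      have "last v \<in> A"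
        using set_v v_nonempty by auto
      with x const v_nonempty have "last v # x \<in> extensions (Suc k)"
        by (auto simp: extensions_def successively_append_iff successively_Cons)
      moreover have "u = drop (Suc k) v @ last v # x"
        using x shift by simp
      ultimately show "u \<in> sphere (Suc k)"
        using assms by (auto simp: sphere_eq)
    qed
  qed
qed

lemma max_sphere_nonempty_iff:
  assumes "k < i"
  shows "max_sphere (with_proj (chain_digraph A R D)) k i v \<noteq> {} \<longleftrightarrow> k \<in> maximal_below sphere i"
  using assms sphere_nonempty
  by (simp add: max_sphere_def maximal_below_def walk_sphere_eq_sphere)

theorem card_dist_sphere:
  assumes "i \<le> D"
  shows "int (card (dist_sphere (with_proj (chain_digraph A R D)) i v)) =
           int d ^ i - (\<Sum>k\<in>maximal_below sphere i. int d ^ k)"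
proof -
  have "(\<Sum>k\<in>maximal_below sphere i. int (card (sphere k))) =
        (\<Sum>k\<in>maximal_below sphere i. int d ^ k)"
    using assms by (intro sum.cong) (auto simp: maximal_below_def card_sphere)
  moreover have "int (card (sphere i - (\<Union>k<i. sphere k))) =
      int (card (sphere i)) - (\<Sum>k\<in>maximal_below sphere i. int (card (sphere k)))"
    using assms finite_sphere sphere_laminar by (intro card_diff_laminar) auto
  ultimately show ?thesis
    using assms by (simp add: digraph.dist_sphere_eq walk_sphere_eq_sphere card_sphere)
qed

text \<open>The coefficients are the indicators of \<open>maximal_below sphere i\<close>. The radius \<open>i - 1\<close> belongs to this set
  as soon as its sphere is contained in the one of radius \<open>i\<close>, since the maximality condition is vacuous.\<close>

theorem dist_sphere_coefficients:
  assumes "i \<le> D"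
  shows "\<exists>a :: nat \<Rightarrow> int.
           int (card (dist_sphere (with_proj (chain_digraph A R D)) i v)) =
             int d ^ i - (\<Sum>k<i. a k * int d ^ k) \<and>
           (\<forall>k<i. a k \<in> {0, 1} \<and>
              (a k = 1 \<longleftrightarrow> max_sphere (with_proj (chain_digraph A R D)) k i v \<noteq> {})) \<and>
           (i \<ge> 1 \<longrightarrow>
              (a (i - 1) = 1 \<longleftrightarrow>
                 R (last v) (last v) \<and> (\<forall>j\<in>{i..<D}. v ! (j - 1) = v ! j)))"
proof (intro exI conjI)
  let ?a = "\<lambda>k. of_bool (k \<in> maximal_below sphere i) :: int"
  have "(\<Sum>k<i. ?a k * int d ^ k) = (\<Sum>k\<in>maximal_below sphere i. int d ^ k)"
    by (rule sum.mono_neutral_cong_right) (auto simp: maximal_below_def)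
  then show "int (card (dist_sphere (with_proj (chain_digraph A R D)) i v)) =
      int d ^ i - (\<Sum>k<i. ?a k * int d ^ k)"
    using card_dist_sphere[OF assms] by simp
  show "\<forall>k<i. ?a k \<in> {0, 1} \<and>
      (?a k = 1 \<longleftrightarrow> max_sphere (with_proj (chain_digraph A R D)) k i v \<noteq> {})"
    using max_sphere_nonempty_iff by auto
  show "i \<ge> 1 \<longrightarrow>
      (?a (i - 1) = 1 \<longleftrightarrow> R (last v) (last v) \<and> (\<forall>j\<in>{i..<D}. v ! (j - 1) = v ! j))"
  proof
    assume "i \<ge> 1"
    then obtain k where i: "i = Suc k"
      by (cases i) auto
    then have "k \<in> maximal_below sphere i \<longleftrightarrow> sphere k \<subseteq> sphere (Suc k)"
      by (auto simp: maximal_below_def)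
    then show "?a (i - 1) = 1 \<longleftrightarrow> R (last v) (last v) \<and> (\<forall>j\<in>{i..<D}. v ! (j - 1) = v ! j)"
      using sphere_subset_sphere_Suc_iff[of k] assms i by simp
  qed
qed

end

section \<open>De Bruijn and Kautz digraphs\<close>

theorem proposition1:
  fixes G :: "'a list pair_pre_digraph" and d D i :: nat and v :: "'a list"
  assumes "d \<ge> 2" and "D \<ge> 1"
    and "is_de_bruijn d D G \<or> is_kautz d D G"
    and "v \<in> pverts G" and "i \<le> D"
  shows "\<exists>a :: nat \<Rightarrow> int.
           int (card (dist_sphere G i v)) = int d ^ i - (\<Sum>k<i. a k * int d ^ k) \<and>
           (\<forall>k<i. a k \<in> {0, 1} \<and> (a k = 1 \<longleftrightarrow> max_sphere G k i v \<noteq> {})) \<and>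
           (i \<ge> 1 \<longrightarrow>
              (a (i - 1) = 1 \<longleftrightarrow>
                 is_de_bruijn d D G \<and> (\<forall>j\<in>{i..<D}. v ! (j - 1) = v ! j)))"
proof (cases "is_de_bruijn d D G")
  case True
  then obtain A where A: "finite A" "card A = d" "G = chain_digraph A (\<lambda>_ _. True) D"
    unfolding is_de_bruijn_def de_bruijn_eq_chain_digraph by blast
  interpret regular_chain A "\<lambda>_ _. True" d D v
    using A assms by unfold_locales (auto simp: chain_digraph_def)
  show ?thesis
    using dist_sphere_coefficients[OF \<open>i \<le> D\<close>] True by (simp add: A(3))
next
  case False
  with assms(3) obtain A where A: "finite A" "card A = d + 1" "G = chain_digraph A (\<noteq>) D"
    unfolding is_kautz_def kautz_eq_chain_digraph by blast
  have "card {y \<in> A. x \<noteq> y} = d" if "x \<in> A" for x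
  proof -
    have "{y \<in> A. x \<noteq> y} = A - {x}" by auto
    with that A show ?thesis by simp
  qed
  then interpret regular_chain A "(\<noteq>)" d D v
    using A assms by unfold_locales (auto simp: chain_digraph_def)
  \<comment> \<open>For \<open>R = (\<noteq>)\<close> the condition \<open>R (last v) (last v)\<close> is false, so the last equivalence has two false sides.\<close>
  show ?thesis
    using dist_sphere_coefficients[OF \<open>i \<le> D\<close>] False by (simp add: A(3))
qed

end
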